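(* Let $N\ge1$ be an integer, let $B,R>0$, let $X\subseteq\mathbb{R}^n$ be a nonempty closed convex set, and let $f$ be a convex function whose domain contains $X$, with $\partial f(x)\ne\emptyset$ for every $x\in X$ and with $B$-bounded subgradients on $X$. Let $x^*$ be a minimizer of $f$ over $X$ and let $x^1\in X$ satisfy $\|x^1-x^*\|\le R$. Let $$h^\star=\frac{1}{s_{N+1}\sqrt{s_{N+1}^2-2N}},$$ and let $x^2,\dots,x^{N+1}$ be generated by $x^{k+1}=P_X\left(x^k-h^\star\tfrac{R}{B}g^k\right)$ with $g^k\in\partial f(x^k)$, $k=1,\dots,N$. Then $$f(x^{N+1})-f(x^* )\le\frac{BR}{\sqrt{N+1}}\sqrt{1+\tfrac14\log(N)}.$$
   Context: $\|\cdot\|$ is the Euclidean norm, $P_X$ is the Euclidean projection onto $X$, and $\log$ is the natural logarithm. The subdifferential is $\partial f(x)=\{g\in\mathbb{R}^n : f(y)\ge f(x)+\langle g,y-x\rangle \text{ for all } y\in\mathrm{dom} f\}$. The function $f$ has $B$-bounded subgradients on $X$ if $\|g\|\le B$ for all $x\in X$ and $g\in\partial f(x)$. The real sequence $(s_k)_{k\ge1}$ is defined by $s_1=1$ and $s_{k+1}=s_k+\frac{1}{s_k}$. *)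

theory Defs
  imports "HOL-Analysis.Analysis"
begin

text \<open>An extended-valued convex function is represented by its effective domain \<open>D\<close>
  and a real-valued \<open>f\<close> of which only the values on \<open>D\<close> matter.  Outside \<open>D\<close>
  the subdifferential is empty, as it is for \<open>f x = \<infinity>\<close>.\<close>

definition subdifferential :: "(real ^ 'n) set \<Rightarrow> (real ^ 'n \<Rightarrow> real) \<Rightarrow> real ^ 'n \<Rightarrow> (real ^ 'n) set"
  where "subdifferential D f x =
    {g. x \<in> D \<and> (\<forall>y\<in>D. f y \<ge> f x + g \<bullet> (y - x))}"

definition bounded_subgradients ::
    "real \<Rightarrow> (real ^ 'n) set \<Rightarrow> (real ^ 'n \<Rightarrow> real) \<Rightarrow> (real ^ 'n) set \<Rightarrow> bool"
  where "bounded_subgradients B D f X \<longleftrightarrow>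
    (\<forall>x\<in>X. \<forall>g\<in>subdifferential D f x. norm g \<le> B)"

text \<open>The sequence is indexed from 1; the value at 0 is irrelevant.\<close>

fun s_seq :: "nat \<Rightarrow> real" where
  "s_seq 0 = 0"
| "s_seq (Suc 0) = 1"
| "s_seq (Suc (Suc k)) = s_seq (Suc k) + 1 / s_seq (Suc k)"

definition h_star :: "nat \<Rightarrow> real" where
  "h_star N = 1 / (s_seq (N + 1) * sqrt ((s_seq (N + 1))\<^sup>2 - 2 * real N))"

end

theory Submission
  imports Defs
begin

text \<open>Write \<open>\<eta> = h R / B\<close> for the step length and \<open>s\<close> for the sequence.  Starting from
  \<open>z\<^sub>0 = x\<^sup>*\<close>, let \<open>z\<^sub>m\<close> be the convex combination of \<open>x\<^sup>m\<close> and \<open>z\<^sub>m\<^sub>-\<^sub>1\<close> in which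
  \<open>z\<^sub>m\<^sub>-\<^sub>1\<close> has weight \<open>s\<^sub>j / s\<^sub>j\<^sub>+\<^sub>1\<close>, where \<open>j = N + 1 - m\<close>.  The recursion for \<open>s\<close> is exactly what makes all
  terms \<open>f(x\<^sup>m)\<close> cancel in the one-step estimate of the potential
  \<open>\<parallel>x\<^sup>m\<^sup>+\<^sup>1 - z\<^sub>m\<parallel>\<^sup>2 / s\<^sub>j\<^sup>2 + 2 \<eta> f(z\<^sub>m)\<close>, which therefore grows by at most \<open>\<eta>\<^sup>2 B\<^sup>2 / s\<^sub>j\<^sup>2\<close>.
  Since \<open>1 / s\<^sub>j\<^sup>2 = s\<^sub>j\<^sub>+\<^sub>1\<^sup>2 - s\<^sub>j\<^sup>2 - 2\<close>, these increments telescope; comparing \<open>f(x\<^sup>N\<^sup>+\<^sup>1)\<close> with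
  \<open>f(z\<^sub>N)\<close> through one more subgradient gives the rate \<open>B R sqrt (s\<^sub>N\<^sub>+\<^sub>1\<^sup>2 - 2 N) / s\<^sub>N\<^sub>+\<^sub>1\<close>.\<close>

section \<open>Growth of the sequence and the resulting rate\<close>

lemma s_seq_Suc: "k \<ge> 1 \<Longrightarrow> s_seq (Suc k) = s_seq k + 1 / s_seq k"
  by (cases k) auto

lemma s_seq_ge_1: "k \<ge> 1 \<Longrightarrow> s_seq k \<ge> 1"
proof (induction k rule: nat_induct_at_least)
  case (Suc k)
  then have "1 / s_seq k \<ge> 0" by simp
  with Suc s_seq_Suc[of k] show ?case by linarith
qed simp

lemma s_seq_Suc_square:
  assumes "k \<ge> 1"
  shows "(s_seq (Suc k))\<^sup>2 = (s_seq k)\<^sup>2 + 2 + 1 / (s_seq k)\<^sup>2"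
  using s_seq_ge_1[OF assms]
  by (simp add: s_seq_Suc[OF assms] power2_eq_square field_simps)

text \<open>Crude growth from dropping \<open>1 / (s_seq k)\<^sup>2\<close> in the squared
  recursion. It keeps the radicand in \<open>h_star\<close> positive and controls the dropped term
  in the upper bound.\<close>

lemma s_seq_Suc_square_ge: "k \<ge> 1 \<Longrightarrow> (s_seq (Suc k))\<^sup>2 \<ge> 2 * real k + 2"
proof (induction k rule: nat_induct_at_least)
  case base
  then show ?case by (simp add: power2_eq_square)
next
  case (Suc k)
  have "2 * real (Suc k) + 2 \<le> (s_seq (Suc k))\<^sup>2 + 2"
    using Suc.IH by simp
  also have "\<dots> \<le> (s_seq (Suc k))\<^sup>2 + 2 + 1 / (s_seq (Suc k))\<^sup>2"
    by simp
  also have "\<dots> = (s_seq (Suc (Suc k)))\<^sup>2"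
    by (rule s_seq_Suc_square[symmetric]) simp
  finally show ?case .
qed

lemma inverse_Suc_le_ln_diff:
  assumes "k \<ge> 1"
  shows "1 / real (Suc k) \<le> ln (real (Suc k)) - ln (real k)"
proof -
  have "ln (real k / real (Suc k)) \<le> real k / real (Suc k) - 1"
    using assms by (intro ln_le_minus_one) auto
  also have "\<dots> = - (1 / real (Suc k))"
    by (simp add: field_simps)
  finally show ?thesis
    using assms by (simp add: ln_div)
qed

text \<open>By the lower bound, each increment exceeds 2 by at most half a harmonic term, and these
  terms are dominated by increments of \<open>ln\<close>. The base case is an equality, so no
  additive constant appears.\<close>

lemma s_seq_Suc_square_le:
  "k \<ge> 1 \<Longrightarrow> (s_seq (Suc k))\<^sup>2 \<le> 2 * real k + 2 + ln (real k) / 2"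
proof (induction k rule: nat_induct_at_least)
  case base
  then show ?case by (simp add: power2_eq_square)
next
  case (Suc k)
  have "1 / (s_seq (Suc k))\<^sup>2 \<le> 1 / (2 * real k + 2)"
    using s_seq_Suc_square_ge[OF Suc(1)] by (intro frac_le) auto
  also have "\<dots> = (1 / real (Suc k)) / 2"
    by (simp add: field_simps)
  also have "\<dots> \<le> (ln (real (Suc k)) - ln (real k)) / 2"
    using inverse_Suc_le_ln_diff[OF Suc(1)] by (rule divide_right_mono) simp
  finally have "1 / (s_seq (Suc k))\<^sup>2 \<le> (ln (real (Suc k)) - ln (real k)) / 2" .
  moreover have "(s_seq (Suc (Suc k)))\<^sup>2 = (s_seq (Suc k))\<^sup>2 + 2 + 1 / (s_seq (Suc k))\<^sup>2"
    by (rule s_seq_Suc_square) simp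
  ultimately show ?case using Suc.IH by (simp add: diff_divide_distrib)
qed

lemma rate_le:
  assumes "N \<ge> 1"
  shows "sqrt ((s_seq (N + 1))\<^sup>2 - 2 * real N) / s_seq (N + 1)
    \<le> sqrt (1 + 1 / 4 * ln (real N)) / sqrt (real N + 1)"
proof -
  define L where "L = ln (real N) / 4"
  have "L \<ge> 0" using assms by (simp add: L_def)
  have N: "real N \<ge> 1" using assms by simp
  define u where "u = (s_seq (N + 1))\<^sup>2"
  have u: "2 * real N + 2 \<le> u" "u \<le> 2 * real N + 2 + 2 * L"
    using s_seq_Suc_square_ge[OF assms] s_seq_Suc_square_le[OF assms]
    by (simp_all add: u_def L_def)
  \<comment> \<open>The upper bound on \<open>u\<close> is spent only on the multiple by
    \<open>N\<close>; the lower bound then absorbs \<open>2 * N * L\<close> into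
    \<open>L * u\<close>.\<close>
  have "(u - 2 * real N) * (real N + 1) = real N * (u - 2 * real N) + (u - 2 * real N)"
    by (simp add: algebra_simps)
  also have "\<dots> \<le> real N * (2 + 2 * L) + (u - 2 * real N)"
    using u N by (intro add_right_mono mult_left_mono) auto
  also have "\<dots> \<le> (1 + L) * u"
    using mult_left_mono[OF u(1) \<open>L \<ge> 0\<close>] \<open>L \<ge> 0\<close> by (simp add: algebra_simps)
  finally have "(u - 2 * real N) / u \<le> (1 + L) / (real N + 1)"
    using u N by (simp add: divide_simps)
  then have "sqrt ((u - 2 * real N) / u) \<le> sqrt ((1 + L) / (real N + 1))"
    by (rule real_sqrt_le_mono)
  moreover have "sqrt u = s_seq (N + 1)"
    using s_seq_ge_1[of "N + 1"] by (simp add: u_def)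
  ultimately show ?thesis
    by (simp add: real_sqrt_divide u_def L_def)
qed

section \<open>One projected subgradient step\<close>

text \<open>The projection is nonexpansive and fixes \<open>z\<close>; the rest is expanding the
  square.\<close>

lemma closest_point_subgradient_step:
  fixes x z g :: "'a::euclidean_space"
  assumes "convex X" "closed X" "z \<in> X"
  shows "(norm (closest_point X (x - \<eta> *\<^sub>R g) - z))\<^sup>2
    \<le> (norm (x - z))\<^sup>2 - 2 * \<eta> * (g \<bullet> (x - z)) + \<eta>\<^sup>2 * (norm g)\<^sup>2"
proof -
  have "dist (closest_point X (x - \<eta> *\<^sub>R g)) (closest_point X z) \<le> dist (x - \<eta> *\<^sub>R g) z"
    using assms by (intro closest_point_lipschitz) auto
  then have "norm (closest_point X (x - \<eta> *\<^sub>R g) - z) \<le> norm (x - \<eta> *\<^sub>R g - z)"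
    using assms by (simp add: closest_point_self dist_norm)
  then have "(norm (closest_point X (x - \<eta> *\<^sub>R g) - z))\<^sup>2 \<le> (norm (x - \<eta> *\<^sub>R g - z))\<^sup>2"
    by (intro power_mono) auto
  also have "\<dots> = (norm (x - z))\<^sup>2 - 2 * \<eta> * (g \<bullet> (x - z)) + \<eta>\<^sup>2 * (norm g)\<^sup>2"
    unfolding power2_norm_eq_inner
    by (simp add: inner_diff_left inner_diff_right inner_commute power2_eq_square algebra_simps)
  finally show ?thesis .
qed

text \<open>Applied with \<open>a\<close>, \<open>b\<close> consecutive terms of
  \<open>s_seq\<close>. The witness depends on \<open>x\<close> and \<open>z\<close> but not on
  \<open>g\<close>.\<close>

lemma potential_step:
  fixes x y z g :: "'a::euclidean_space" and a b \<eta> B :: real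
  assumes conv: "convex_on X f" and clos: "closed X" and X: "x \<in> X" "z \<in> X"
    and sub: "\<And>w. w \<in> X \<Longrightarrow> f x + g \<bullet> (w - x) \<le> f w"
    and g: "norm g \<le> B" and "a > 0" and "\<eta> \<ge> 0" and b: "b = a + 1 / a"
    and y: "y = closest_point X (x - \<eta> *\<^sub>R g)"
  shows "\<exists>w\<in>X. (norm (y - w))\<^sup>2 / a\<^sup>2 + 2 * \<eta> * f w
    \<le> (norm (x - z))\<^sup>2 / b\<^sup>2 + 2 * \<eta> * f z + \<eta>\<^sup>2 * B\<^sup>2 / a\<^sup>2"
proof -
  have cX: "convex X" using conv by (rule convex_on_imp_convex)
  have "b > 0" using b \<open>a > 0\<close> by (simp add: add_pos_pos)
  define t where "t = a / b"
  have "a \<le> b" using b \<open>a > 0\<close> by simp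
  then have t: "0 < t" "t \<le> 1" using \<open>a > 0\<close> \<open>b > 0\<close> by (auto simp: t_def)
  \<comment> \<open>The only use of the exact form of \<open>b\<close>: it gives \<open>f x\<close>
    the same coefficient \<open>1 / a\<^sup>2\<close> in the convexity bound \<open>fw\<close> as in
    the scaled subgradient step, so that \<open>f x\<close> cancels.\<close>
  have t_inverse: "1 + 1 / a\<^sup>2 = 1 / t"
    using \<open>a > 0\<close> by (simp add: t_def b power2_eq_square add_divide_distrib)
  have t_a: "t\<^sup>2 / a\<^sup>2 = 1 / b\<^sup>2"
    using \<open>a > 0\<close> by (simp add: t_def power_divide)
  define w where "w = (1 - t) *\<^sub>R x + t *\<^sub>R z"
  have "w \<in> X" unfolding w_def using convexD[OF cX X, of "1 - t" t] t by simp
  have "f w \<le> (1 - t) * f x + t * f z"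
    unfolding w_def using convex_onD[OF conv, of t x z] t X by simp
  then have "f w / t \<le> ((1 - t) * f x + t * f z) / t"
    using t by (intro divide_right_mono) auto
  also have "\<dots> = (1 / t - 1) * f x + f z"
    using t by (simp add: field_simps)
  finally have "f w * (1 / t) \<le> (1 / t - 1) * f x + f z" by simp
  then have fw: "f w + f w / a\<^sup>2 \<le> f x / a\<^sup>2 + f z"
    unfolding t_inverse[symmetric] by (simp add: distrib_left)
  \<comment> \<open>Moving the reference point from \<open>z\<close> to \<open>w\<close> shrinks the
    distance by \<open>t\<close>, which by \<open>t_a\<close> turns the weight
    \<open>1 / a\<^sup>2\<close> into \<open>1 / b\<^sup>2\<close>.\<close>
  have "x - w = t *\<^sub>R (x - z)" by (simp add: w_def algebra_simps)
  then have xw: "(norm (x - w))\<^sup>2 = t\<^sup>2 * (norm (x - z))\<^sup>2"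
    by (simp add: power_mult_distrib)
  have "f x - f w \<le> g \<bullet> (x - w)"
    using sub[OF \<open>w \<in> X\<close>] by (simp add: inner_diff_right)
  then have "2 * \<eta> * (f x - f w) \<le> 2 * \<eta> * (g \<bullet> (x - w))"
    using \<open>\<eta> \<ge> 0\<close> by (intro mult_left_mono) auto
  moreover have "\<eta>\<^sup>2 * (norm g)\<^sup>2 \<le> \<eta>\<^sup>2 * B\<^sup>2"
    using g by (intro mult_left_mono power_mono) auto
  ultimately have "(norm (y - w))\<^sup>2 \<le> t\<^sup>2 * (norm (x - z))\<^sup>2 - 2 * \<eta> * (f x - f w) + \<eta>\<^sup>2 * B\<^sup>2"
    using closest_point_subgradient_step[OF cX clos \<open>w \<in> X\<close>, of x \<eta> g, folded y] xw by linarith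
  then have "(norm (y - w))\<^sup>2 / a\<^sup>2
      \<le> (t\<^sup>2 * (norm (x - z))\<^sup>2 - 2 * \<eta> * (f x - f w) + \<eta>\<^sup>2 * B\<^sup>2) / a\<^sup>2"
    by (rule divide_right_mono) simp
  also have "\<dots> = t\<^sup>2 / a\<^sup>2 * (norm (x - z))\<^sup>2 - 2 * \<eta> * (f x / a\<^sup>2 - f w / a\<^sup>2) + \<eta>\<^sup>2 * B\<^sup>2 / a\<^sup>2"
    by (simp add: add_divide_distrib diff_divide_distrib right_diff_distrib)
  finally have "(norm (y - w))\<^sup>2 / a\<^sup>2
      \<le> (norm (x - z))\<^sup>2 / b\<^sup>2 - 2 * \<eta> * (f x / a\<^sup>2 - f w / a\<^sup>2) + \<eta>\<^sup>2 * B\<^sup>2 / a\<^sup>2"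
    by (simp add: t_a)
  moreover have "2 * \<eta> * (f w + f w / a\<^sup>2) \<le> 2 * \<eta> * (f x / a\<^sup>2 + f z)"
    using fw \<open>\<eta> \<ge> 0\<close> by (intro mult_left_mono) auto
  ultimately have "(norm (y - w))\<^sup>2 / a\<^sup>2 + 2 * \<eta> * f w
      \<le> (norm (x - z))\<^sup>2 / b\<^sup>2 + 2 * \<eta> * f z + \<eta>\<^sup>2 * B\<^sup>2 / a\<^sup>2"
    by (simp add: algebra_simps)
  with \<open>w \<in> X\<close> show ?thesis by blast
qed

section \<open>Telescoping the potential over all steps\<close>

lemma last_iterate_bound:
  fixes x g :: "nat \<Rightarrow> 'a::euclidean_space"
  assumes conv: "convex_on X f" and clos: "closed X"
    and xX: "\<And>k. 1 \<le> k \<Longrightarrow> k \<le> N + 1 \<Longrightarrow> x k \<in> X" and "z0 \<in> X"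
    and sub: "\<And>k w. 1 \<le> k \<Longrightarrow> k \<le> N + 1 \<Longrightarrow> w \<in> X \<Longrightarrow> f (x k) + g k \<bullet> (w - x k) \<le> f w"
    and g: "\<And>k. 1 \<le> k \<Longrightarrow> k \<le> N + 1 \<Longrightarrow> norm (g k) \<le> B" and "\<eta> \<ge> 0"
    and step: "\<And>k. 1 \<le> k \<Longrightarrow> k \<le> N \<Longrightarrow> x (k + 1) = closest_point X (x k - \<eta> *\<^sub>R g k)"
  shows "2 * \<eta> * (f (x (N + 1)) - f z0)
    \<le> (norm (x 1 - z0))\<^sup>2 / (s_seq (N + 1))\<^sup>2 + \<eta>\<^sup>2 * B\<^sup>2 * ((s_seq (N + 1))\<^sup>2 - 2 * real N)"
proof -
  \<comment> \<open>A discrete antiderivative: \<open>?w (j + 1) - ?w j\<close> is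
    \<open>1 / (s_seq (j + 1))\<^sup>2\<close>, the error of one step up to the factor \<eta>^2
    B^2.\<close>
  let ?w = "\<lambda>j. (s_seq (j + 1))\<^sup>2 - 2 * real j"
  let ?C = "(norm (x 1 - z0))\<^sup>2 / (s_seq (N + 1))\<^sup>2 + 2 * \<eta> * f z0"
  have "\<exists>z\<in>X. (norm (x (m + 1) - z))\<^sup>2 / (s_seq (N - m + 1))\<^sup>2 + 2 * \<eta> * f z
      \<le> ?C + \<eta>\<^sup>2 * B\<^sup>2 * (?w N - ?w (N - m))" if "m \<le> N" for m
    using that
  proof (induction m)
    case 0
    then show ?case using \<open>z0 \<in> X\<close> by (intro bexI[of _ z0]) auto
  next
    case (Suc m)
    define j where "j = N - Suc m"
    have j: "N - m = Suc j" using Suc.prems by (simp add: j_def)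
    obtain z where z: "z \<in> X" "(norm (x (m + 1) - z))\<^sup>2 / (s_seq (Suc j + 1))\<^sup>2 + 2 * \<eta> * f z
        \<le> ?C + \<eta>\<^sup>2 * B\<^sup>2 * (?w N - ?w (Suc j))"
      using Suc.IH Suc.prems unfolding j by auto
    have "\<exists>w\<in>X. (norm (x (m + 1 + 1) - w))\<^sup>2 / (s_seq (j + 1))\<^sup>2 + 2 * \<eta> * f w
      \<le> (norm (x (m + 1) - z))\<^sup>2 / (s_seq (Suc j + 1))\<^sup>2 + 2 * \<eta> * f z
        + \<eta>\<^sup>2 * B\<^sup>2 / (s_seq (j + 1))\<^sup>2"
      using s_seq_ge_1[of "j + 1"] Suc.prems \<open>\<eta> \<ge> 0\<close>
      by (intro potential_step[where g = "g (m + 1)"] conv clos xX z(1) sub g step)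
        (auto simp: s_seq_Suc)
    then obtain w where w: "w \<in> X"
      "(norm (x (m + 1 + 1) - w))\<^sup>2 / (s_seq (j + 1))\<^sup>2 + 2 * \<eta> * f w
      \<le> (norm (x (m + 1) - z))\<^sup>2 / (s_seq (Suc j + 1))\<^sup>2 + 2 * \<eta> * f z
        + \<eta>\<^sup>2 * B\<^sup>2 / (s_seq (j + 1))\<^sup>2" by blast
    have w_diff: "?w (Suc j) = ?w j + 1 / (s_seq (j + 1))\<^sup>2"
      using s_seq_Suc_square[of "j + 1"] by simp
    have "\<eta>\<^sup>2 * B\<^sup>2 / (s_seq (j + 1))\<^sup>2 + \<eta>\<^sup>2 * B\<^sup>2 * (?w N - ?w (Suc j)) = \<eta>\<^sup>2 * B\<^sup>2 * (?w N - ?w j)"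
      unfolding w_diff by (simp add: algebra_simps)
    with w(2) z(2) have "(norm (x (m + 1 + 1) - w))\<^sup>2 / (s_seq (j + 1))\<^sup>2 + 2 * \<eta> * f w
      \<le> ?C + \<eta>\<^sup>2 * B\<^sup>2 * (?w N - ?w j)" by linarith
    with w(1) show ?case by (auto simp: j_def)
  qed
  \<comment> \<open>Here the weight is \<open>s_seq 1 = 1\<close>, and \<open>?w 0 = 1\<close>
    leaves exactly one unit of \<eta>^2 B^2 to spare.\<close>
  from this[of N] obtain z where z: "z \<in> X"
    "(norm (x (N + 1) - z))\<^sup>2 + 2 * \<eta> * f z \<le> ?C + \<eta>\<^sup>2 * B\<^sup>2 * (?w N - 1)"
    by auto
  let ?d = "norm (x (N + 1) - z)"
  have "f (x (N + 1)) - f z \<le> g (N + 1) \<bullet> (x (N + 1) - z)"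
    using sub[of "N + 1" z] z(1) by (simp add: inner_diff_right)
  also have "\<dots> \<le> norm (g (N + 1)) * ?d" by (rule norm_cauchy_schwarz)
  also have "\<dots> \<le> B * ?d" using g[of "N + 1"] by (intro mult_right_mono) auto
  finally have "2 * \<eta> * (f (x (N + 1)) - f z) \<le> 2 * \<eta> * (B * ?d)"
    using \<open>\<eta> \<ge> 0\<close> by (intro mult_left_mono) auto
  \<comment> \<open>Young's inequality: the squared distance is paid by the potential, the other
    term by the spare unit.\<close>
  also have "\<dots> \<le> ?d\<^sup>2 + \<eta>\<^sup>2 * B\<^sup>2"
    using zero_le_power2[of "?d - \<eta> * B"] by (simp add: power2_eq_square algebra_simps)
  finally show ?thesis using z(2) by (simp add: algebra_simps)
qed

section \<open>Choice of the step length\<close>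

theorem mainTheorem5:
  fixes N :: nat and B R :: real
    and X D :: "(real ^ 'n) set"
    and f :: "real ^ 'n \<Rightarrow> real"
    and xstar :: "real ^ 'n"
    and x g :: "nat \<Rightarrow> real ^ 'n"
  assumes "N \<ge> 1" and "B > 0" and "R > 0"
    and "X \<noteq> {}" and "closed X" and "convex X"
    and "convex_on D f" and "X \<subseteq> D"
    and "\<forall>y\<in>X. subdifferential D f y \<noteq> {}"
    and "bounded_subgradients B D f X"
    and "is_arg_min f (\<lambda>y. y \<in> X) xstar"
    and "x 1 \<in> X" and "norm (x 1 - xstar) \<le> R"
    and "\<forall>k\<in>{1..N}. g k \<in> subdifferential D f (x k)"
    and "\<forall>k\<in>{1..N}. x (k + 1) = closest_point X (x k - (h_star N * (R / B)) *\<^sub>R g k)"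
  shows "f (x (N + 1)) - f xstar \<le> B * R / sqrt (real N + 1) * sqrt (1 + 1 / 4 * ln (real N))"
proof -
  have DX: "convex_on X f"
    using \<open>convex_on D f\<close> \<open>X \<subseteq> D\<close> \<open>convex X\<close> by (rule convex_on_subset)
  define s where "s = s_seq (N + 1)"
  define q where "q = sqrt (s\<^sup>2 - 2 * real N)"
  have "s \<ge> 1" unfolding s_def by (rule s_seq_ge_1) simp
  have sq: "s\<^sup>2 - 2 * real N \<ge> 2"
    using s_seq_Suc_square_ge[OF \<open>N \<ge> 1\<close>] by (simp add: s_def)
  then have "q > 0" and q2: "q\<^sup>2 = s\<^sup>2 - 2 * real N" by (simp_all add: q_def)
  define \<eta> where "\<eta> = h_star N * (R / B)"
  have \<eta>: "\<eta> = R / (B * s * q)" by (simp add: \<eta>_def h_star_def s_def q_def)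
  then have "\<eta> > 0" using \<open>B > 0\<close> \<open>R > 0\<close> \<open>s \<ge> 1\<close> \<open>q > 0\<close> by simp
  have xX: "x k \<in> X" if "1 \<le> k" "k \<le> N + 1" for k
  proof (cases "k = 1")
    case False
    with that have "k - 1 \<in> {1..N}" by auto
    then have "x (k - 1 + 1) = closest_point X (x (k - 1) - \<eta> *\<^sub>R g (k - 1))"
      using assms(15) unfolding \<eta>_def by blast
    with that show ?thesis using closest_point_in_set[OF \<open>closed X\<close> \<open>X \<noteq> {}\<close>] by simp
  qed (use \<open>x 1 \<in> X\<close> in simp)
  \<comment> \<open>The method uses no subgradient at the final iterate, but the comparison with the
    last reference point does; nonemptiness of the subdifferential supplies it.\<close>
  obtain gl where gl: "gl \<in> subdifferential D f (x (N + 1))"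
    using assms(9) xX[of "N + 1"] by auto
  define g' where "g' = g(N + 1 := gl)"
  have g'_sub: "g' k \<in> subdifferential D f (x k)" if "1 \<le> k" "k \<le> N + 1" for k
    using that assms(14) gl by (auto simp: g'_def)
  have xstar: "xstar \<in> X" using assms(11) by (simp add: is_arg_min_def)
  have "2 * \<eta> * (f (x (N + 1)) - f xstar)
    \<le> (norm (x 1 - xstar))\<^sup>2 / (s_seq (N + 1))\<^sup>2 + \<eta>\<^sup>2 * B\<^sup>2 * ((s_seq (N + 1))\<^sup>2 - 2 * real N)"
  proof (rule last_iterate_bound[where g = g' and X = X])
    fix k assume k: "1 \<le> k" "k \<le> N + 1"
    show "norm (g' k) \<le> B"
      using assms(10) xX[OF k] g'_sub[OF k] by (auto simp: bounded_subgradients_def)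
    show "f (x k) + g' k \<bullet> (w - x k) \<le> f w" if "w \<in> X" for w
      using g'_sub[OF k] that \<open>X \<subseteq> D\<close> by (auto simp: subdifferential_def)
  next
    fix k assume "1 \<le> k" "k \<le> N"
    then show "x (k + 1) = closest_point X (x k - \<eta> *\<^sub>R g' k)"
      using assms(15) by (simp add: g'_def \<eta>_def)
  qed (use DX \<open>closed X\<close> xX xstar \<open>\<eta> > 0\<close> in auto)
  also have "\<dots> \<le> R\<^sup>2 / s\<^sup>2 + \<eta>\<^sup>2 * B\<^sup>2 * q\<^sup>2"
    using assms(13) by (auto simp: s_def q2 intro!: divide_right_mono power_mono)
  \<comment> \<open>This \<eta> balances the distance term and the error term: both equal
    \<open>R\<^sup>2 / s\<^sup>2\<close>, which minimizes their sum divided by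
    \<open>2 * \<eta>\<close>.\<close>
  also have "\<dots> = 2 * \<eta> * (B * R * (q / s))"
    using \<open>B > 0\<close> \<open>s \<ge> 1\<close> \<open>q > 0\<close> by (simp add: \<eta> power2_eq_square field_simps)
  finally have "f (x (N + 1)) - f xstar \<le> B * R * (q / s)"
    by (rule mult_left_le_imp_le) (use \<open>\<eta> > 0\<close> in simp)
  also have "\<dots> \<le> B * R * (sqrt (1 + 1 / 4 * ln (real N)) / sqrt (real N + 1))"
    using rate_le[OF \<open>N \<ge> 1\<close>] \<open>B > 0\<close> \<open>R > 0\<close>
    by (intro mult_left_mono) (simp_all add: q_def s_def)
  finally show ?thesis by simp
qed

end
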